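(* For every formula $\varphi$ of propositional linear temporal logic (LTL), the formula $\varphi\leftrightarrow\bigcirc\Box\neg\varphi$ is not provable in LTL.
   Context: Formulas of propositional linear temporal logic (LTL) are built from a set $\mathtt{Atoms}$ of propositional atoms using the Boolean connectives (conjunction $\wedge$ and negation $\neg$, with the other connectives such as $\leftrightarrow$ defined as usual) and two unary modalities: $\bigcirc$ ("next") and $\Box$ ("always", i.e. now and forever in the future). A model is a pair $\langle\mathbb{N},\Vdash\rangle$, where $\Vdash\ \subseteq\mathbb{N}\times\mathtt{Atoms}$ is an arbitrary relation, extended to all formulas by: - $n\Vdash\varphi\wedge\psi$ iff $n\Vdash\varphi$ and $n\Vdash\psi$; - $n\Vdash\neg\varphi$ iff $n\not\Vdash\varphi$; - $n\Vdash\bigcirc\varphi$ iff $(n+1)\Vdash\varphi$; - $n\Vdash\Box\varphi$ iff $m\Vdash\varphi$ for every $m\geq n$. A formula $\tau$ is valid (an LTL tautology, a law of LTL) when $n\Vdash\tau$ for every model $\langle\mathbb{N},\Vdash\rangle$ and every $n\in\mathbb{N}$. "Provable in LTL" is understood as being valid in this sense. *)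

theory Defs
  imports Main
begin

datatype 'a ltl =
    Atom 'a
  | Neg "'a ltl"
  | Conj "'a ltl" "'a ltl"
  | Next "'a ltl"
  | Always "'a ltl"

definition Imp :: "'a ltl \<Rightarrow> 'a ltl \<Rightarrow> 'a ltl" where
  "Imp \<phi> \<psi> = Neg (Conj \<phi> (Neg \<psi>))"

definition Iff :: "'a ltl \<Rightarrow> 'a ltl \<Rightarrow> 'a ltl" where
  "Iff \<phi> \<psi> = Conj (Imp \<phi> \<psi>) (Imp \<psi> \<phi>)"

text \<open>A model is an arbitrary relation between time points and atoms; \<open>sat V n \<phi>\<close> is its
  extension to all formulas.\<close>

primrec sat :: "(nat \<times> 'a) set \<Rightarrow> nat \<Rightarrow> 'a ltl \<Rightarrow> bool" where
  "sat V n (Atom p) \<longleftrightarrow> (n, p) \<in> V"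
| "sat V n (Neg \<phi>) \<longleftrightarrow> \<not> sat V n \<phi>"
| "sat V n (Conj \<phi> \<psi>) \<longleftrightarrow> sat V n \<phi> \<and> sat V n \<psi>"
| "sat V n (Next \<phi>) \<longleftrightarrow> sat V (n + 1) \<phi>"
| "sat V n (Always \<phi>) \<longleftrightarrow> (\<forall>m\<ge>n. sat V m \<phi>)"

text \<open>Provability in LTL is understood semantically, as truth at every point of every model.\<close>

definition ltl_valid :: "'a ltl \<Rightarrow> bool" where
  "ltl_valid \<phi> \<longleftrightarrow> (\<forall>V n. sat V n \<phi>)"

end

theory Submission
  imports Defs
begin

text \<open>Yablo's paradox: validity would make \<phi> hold at a time iff it fails at all later
  times. If \<phi> held once, it would fail at every later time, hence also hold at the next one. So
  it never holds, and therefore it holds at 0.\<close>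

theorem theorem4p1:
  fixes \<phi> :: "'a ltl"
  shows "\<not> ltl_valid (Iff \<phi> (Next (Always (Neg \<phi>))))"
proof
  assume "ltl_valid (Iff \<phi> (Next (Always (Neg \<phi>))))"
  \<comment> \<open>The choice of \<open>{}\<close> is arbitrary: the contradiction arises within
    any single model.\<close>
  then have yablo: "sat {} n \<phi> \<longleftrightarrow> (\<forall>m\<ge>n + 1. \<not> sat {} m \<phi>)" for n
    unfolding ltl_valid_def Iff_def Imp_def by auto
  have never: "\<not> sat {} n \<phi>" for n
  proof
    assume "sat {} n \<phi>"
    then have later: "\<not> sat {} m \<phi>" if "m \<ge> n + 1" for m
      using yablo that by blast
    \<comment> \<open>Times from \<open>n + 2\<close> on are among those covered by
      \<open>later\<close>.\<close>
    then have "sat {} (n + 1) \<phi>"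
      by (subst yablo) simp
    with later show False by blast
  qed
  then have "sat {} 0 \<phi>"
    by (subst yablo) simp
  with never show False by blast
qed

end
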